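(* Let $e=3$, let $\gamma=(\gamma_1,\gamma_2)\in\mathbb{Q}^{2}$ with $1\le\gamma_1\le\gamma_2$, and let $B\ne\{0\}$ be a finite nonempty subset of $\mathbb{N}^{2}$ whose complement $C=\mathbb{N}^{2}\setminus B$ satisfies $C+\mathbb{N}^{2}\subseteq C$. If $B$ induces a periodic tesselation on $\mathbb{Z}^2$, then $$w(\gamma,B)\ge\frac{1}{e-1}=\frac12 .$$
   Context: $\mathbb{N}=\{0,1,2,\ldots\}$, and $x\cdot\gamma$ is the dot product. $B\subseteq\mathbb{N}^{e-1}$ induces a periodic tesselation on $\mathbb{Z}^{e-1}$ if there is a sublattice (subgroup) $\Lambda\subseteq\mathbb{Z}^{e-1}$ of rank $e-1$ such that $\mathbb{Z}^{e-1}$ is the disjoint union of the translates $\lambda+B$, $\lambda\in\Lambda$. Wilf ratio: put $\max(B\cdot\gamma):=\max\{b\cdot\gamma\mid b\in B\}$, $n_0:=\lfloor\max(B\cdot\gamma)\rfloor$, and for $n=0,\ldots,n_0$ $$h_n:=\#\{b\in B\mid \lfloor b\cdot\gamma\rfloor=n\},\qquad h_n':=\#\{b\in B\mid n_0-\lfloor\max(B\cdot\gamma)-b\cdot\gamma\rfloor=n\}.$$ Then $$w(\gamma,B):=\frac{n_0h_0'+(n_0-1)h_1'+\ldots+0\cdot h_{n_0}'}{0\cdot h_0+1\cdot h_1+\ldots+n_0h_{n_0}}.$$ *)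

theory Defs
  imports "HOL-Analysis.Analysis"
begin

global_interpretation int_vec: module "(*s) :: int \<Rightarrow> int ^ 'n \<Rightarrow> int ^ 'n::finite"
  by unfold_locales (simp_all add: vec_eq_iff algebra_simps)

definition sublattice :: "(int ^ 'n::finite) set \<Rightarrow> bool" where
  "sublattice L \<longleftrightarrow> 0 \<in> L \<and> (\<forall>x\<in>L. \<forall>y\<in>L. x + y \<in> L) \<and> (\<forall>x\<in>L. - x \<in> L)"

text \<open>The rank of a (necessarily free) sublattice is the cardinality of a basis over the integers.\<close>

definition has_rank :: "(int ^ 'n::finite) set \<Rightarrow> nat \<Rightarrow> bool" where
  "has_rank L r \<longleftrightarrow>
     (\<exists>S. finite S \<and> card S = r \<and> int_vec.independent S \<and> int_vec.span S = L)"

definition int_of_nat_vec :: "nat ^ 'n \<Rightarrow> int ^ 'n::finite" where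
  "int_of_nat_vec b = (\<chi> i. int (b $ i))"

definition translate :: "int ^ 'n \<Rightarrow> (nat ^ 'n) set \<Rightarrow> (int ^ 'n::finite) set" where
  "translate l B = (\<lambda>b. l + int_of_nat_vec b) ` B"

definition induces_periodic_tesselation :: "(nat ^ 'n::finite) set \<Rightarrow> bool" where
  "induces_periodic_tesselation B \<longleftrightarrow>
     (\<exists>L. sublattice L \<and> has_rank L CARD('n) \<and>
          (\<Union>l\<in>L. translate l B) = UNIV \<and>
          disjoint_family_on (\<lambda>l. translate l B) L)"

definition dot :: "nat ^ 'n \<Rightarrow> rat ^ 'n::finite \<Rightarrow> rat" where
  "dot b \<gamma> = (\<Sum>i\<in>UNIV. of_nat (b $ i) * \<gamma> $ i)"

definition max_dot :: "rat ^ 'n \<Rightarrow> (nat ^ 'n::finite) set \<Rightarrow> rat" where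
  "max_dot \<gamma> B = Max ((\<lambda>b. dot b \<gamma>) ` B)"

definition wilf_n0 :: "rat ^ 'n \<Rightarrow> (nat ^ 'n::finite) set \<Rightarrow> int" where
  "wilf_n0 \<gamma> B = \<lfloor>max_dot \<gamma> B\<rfloor>"

definition wilf_h :: "rat ^ 'n \<Rightarrow> (nat ^ 'n::finite) set \<Rightarrow> int \<Rightarrow> nat" where
  "wilf_h \<gamma> B n = card {b \<in> B. \<lfloor>dot b \<gamma>\<rfloor> = n}"

definition wilf_h' :: "rat ^ 'n \<Rightarrow> (nat ^ 'n::finite) set \<Rightarrow> int \<Rightarrow> nat" where
  "wilf_h' \<gamma> B n = card {b \<in> B. wilf_n0 \<gamma> B - \<lfloor>max_dot \<gamma> B - dot b \<gamma>\<rfloor> = n}"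

definition wilf_ratio :: "rat ^ 'n \<Rightarrow> (nat ^ 'n::finite) set \<Rightarrow> rat" where
  "wilf_ratio \<gamma> B =
     (\<Sum>n\<in>{0..wilf_n0 \<gamma> B}. of_int (wilf_n0 \<gamma> B - n) * of_nat (wilf_h' \<gamma> B n)) /
     (\<Sum>n\<in>{0..wilf_n0 \<gamma> B}. of_int n * of_nat (wilf_h \<gamma> B n))"

end

(*
  A down-set B that tiles the plane by a lattice has at most one inner corner: such a corner is a
  lattice vector, and the difference of two of them would also be the difference of two points of
  B on the axes. So B is a rectangle or an L-shape. With M = max (B . gamma), the ratio is the
  quotient of the sums of floor (M - b . gamma) and floor (b . gamma) over B, and these two sums
  are compared by reflecting and translating the rectangles that make up B.
*)

theory Submission
  imports Defs
begin

section \<open>Floor sums over L-shapes\<close>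

definition lin :: "'a::floor_ceiling \<Rightarrow> 'a \<Rightarrow> nat \<Rightarrow> nat \<Rightarrow> 'a" where
  "lin \<alpha> \<beta> i j = of_nat i * \<alpha> + of_nat j * \<beta>"

text \<open>The point \<open>(x, y)\<close> is the inner corner of the L. Rectangles are included as
  the case \<open>x = a\<close>, \<open>y = b\<close>, where nothing is cut out.\<close>

definition lshape :: "nat \<Rightarrow> nat \<Rightarrow> nat \<Rightarrow> nat \<Rightarrow> (nat \<times> nat) set" where
  "lshape a b x y = {(i, j). i < a \<and> j < b \<and> \<not> (x \<le> i \<and> y \<le> j)}"

lemma sum_lessThan_add:
  fixes f :: "nat \<Rightarrow> 'b::comm_monoid_add"
  shows "(\<Sum>i<m + n. f i) = (\<Sum>i<m. f i) + (\<Sum>i<n. f (m + i))"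
  by (induction n) (simp_all add: add.assoc)

lemma sum_lshape:
  fixes f :: "nat \<Rightarrow> nat \<Rightarrow> 'b::comm_monoid_add"
  assumes "x \<le> a" "y \<le> b"
  shows "(\<Sum>(i, j)\<in>lshape a b x y. f i j) =
    (\<Sum>i<x. \<Sum>j<b. f i j) + (\<Sum>i<a - x. \<Sum>j<y. f (x + i) j)"
proof -
  have eq: "lshape a b x y = {..<x} \<times> {..<b} \<union> {x..<a} \<times> {..<y}"
    using assms by (auto simp: lshape_def)
  have "(\<Sum>(i, j)\<in>lshape a b x y. f i j) =
      (\<Sum>(i, j)\<in>{..<x} \<times> {..<b}. f i j) + (\<Sum>(i, j)\<in>{x..<a} \<times> {..<y}. f i j)"
    unfolding eq by (rule sum.union_disjoint) auto
  also have "\<dots> = (\<Sum>i<x. \<Sum>j<b. f i j) + (\<Sum>i\<in>{x..<a}. \<Sum>j<y. f i j)"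
    by (simp add: sum.cartesian_product)
  also have "(\<Sum>i\<in>{x..<a}. \<Sum>j<y. f i j) = (\<Sum>i<a - x. \<Sum>j<y. f (x + i) j)"
    using assms sum.shift_bounds_nat_ivl[of "\<lambda>i. \<Sum>j<y. f i j" 0 x "a - x"]
    by (simp add: lessThan_atLeast0 add.commute)
  finally show ?thesis .
qed

lemma sum_rectangle_reflect:
  fixes f :: "nat \<Rightarrow> nat \<Rightarrow> 'b::comm_monoid_add" and m n :: nat
  shows "(\<Sum>i<m. \<Sum>j<n. f (m - Suc i) (n - Suc j)) = (\<Sum>i<m. \<Sum>j<n. f i j)"
proof -
  have "(\<Sum>j<n. f i (n - Suc j)) = (\<Sum>j<n. f i j)" for i
    by (rule sum.nat_diff_reindex)
  then show ?thesis
    using sum.nat_diff_reindex[of "\<lambda>i. \<Sum>j<n. f i j" m] by simp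
qed

text \<open>
  Reflecting the leg \<open>[0, x) \<times> [0, b)\<close> and the foot \<open>[x, a) \<times> [0, y)\<close> bounds
  the sum on the right below by the sum of \<open>\<lfloor>lin \<alpha> \<beta> i j\<rfloor>\<close> over the leg and over
  \<open>[0, a - x) \<times> [0, y)\<close>. What remains of \<open>[0, a) \<times> [0, y)\<close> is moved into the
  leg by the translation \<open>(-(a - x), b - y)\<close>, which does not decrease \<open>lin\<close>.
\<close>

lemma floor_sum_lshape_le:
  fixes \<alpha> \<beta> :: "'a::floor_ceiling"
  assumes "0 \<le> \<alpha>" "0 \<le> \<beta>" and "1 \<le> x" "x \<le> a" "1 \<le> y" "y \<le> b"
    and le: "lin \<alpha> \<beta> (a - 1) (y - 1) \<le> lin \<alpha> \<beta> (x - 1) (b - 1)"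
  shows "(\<Sum>(i, j)\<in>lshape a b x y. \<lfloor>lin \<alpha> \<beta> i j\<rfloor>) \<le>
    2 * (\<Sum>(i, j)\<in>lshape a b x y. \<lfloor>lin \<alpha> \<beta> (x - 1) (b - 1) - lin \<alpha> \<beta> i j\<rfloor>)"
proof -
  \<comment> \<open>\<open>n\<close> is the width of the foot and \<open>d\<close> the height by
    which the leg rises above it; by \<open>le\<close>, \<open>M\<close> is the larger value of
    \<open>lin\<close> at the two outer corners.\<close>
  define n d M where "n = a - x" and "d = b - y" and "M = lin \<alpha> \<beta> (x - 1) (b - 1)"
  have a: "a = x + n" and b: "b = d + y"
    using assms by (auto simp: n_def d_def)
  \<comment> \<open>The outer corners \<open>(a - 1, y - 1)\<close> and
    \<open>(x - 1, b - 1)\<close> differ by \<open>(-n, d)\<close>, so \<open>le\<close> says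
    exactly that this translation does not decrease \<open>lin\<close>.\<close>
  have nd: "of_nat n * \<alpha> \<le> of_nat d * \<beta>"
    using le assms(3,5) by (simp add: lin_def a b of_nat_diff algebra_simps)
  define \<phi> where "\<phi> i j = \<lfloor>lin \<alpha> \<beta> i j\<rfloor>" for i j
  define c where "c i = (\<Sum>j<y. \<phi> i j)" for i
  have \<phi>_nonneg: "0 \<le> \<phi> i j" for i j
    using assms(1,2) by (simp add: \<phi>_def lin_def)
  define S where "S = (\<Sum>i<x. \<Sum>j<b. \<phi> i j)"
  \<comment> \<open>The reflection swaps the origin with the corner where \<open>lin\<close> equals
    \<open>M\<close>, so the leg gives an equality.\<close>
  have leg: "(\<Sum>i<x. \<Sum>j<b. \<lfloor>M - lin \<alpha> \<beta> i j\<rfloor>) = S"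
  proof -
    have "\<lfloor>M - lin \<alpha> \<beta> (x - Suc i) (b - Suc j)\<rfloor> = \<phi> i j" if "i < x" "j < b" for i j
      using that by (simp add: M_def \<phi>_def lin_def of_nat_diff algebra_simps)
    then have "(\<Sum>i<x. \<Sum>j<b. \<lfloor>M - lin \<alpha> \<beta> (x - Suc i) (b - Suc j)\<rfloor>) = S"
      unfolding S_def by (intro sum.cong refl) auto
    then show ?thesis
      using sum_rectangle_reflect[of "\<lambda>i j. \<lfloor>M - lin \<alpha> \<beta> i j\<rfloor>" x b] by simp
  qed
  \<comment> \<open>Reflecting the foot turns \<open>M - lin\<close> into \<open>lin\<close> plus
    the constant \<open>d * \<beta> - n * \<alpha>\<close>, which is nonnegative by
    \<open>nd\<close>.\<close>
  have foot: "(\<Sum>i<n. c i) \<le> (\<Sum>i<n. \<Sum>j<y. \<lfloor>M - lin \<alpha> \<beta> (x + i) j\<rfloor>)"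
  proof -
    have "\<phi> i j \<le> \<lfloor>M - lin \<alpha> \<beta> (x + (n - Suc i)) (y - Suc j)\<rfloor>" if "i < n" "j < y" for i j
      unfolding \<phi>_def using that nd assms(3)
      by (intro floor_mono) (simp add: M_def b lin_def of_nat_diff algebra_simps)
    then have "(\<Sum>i<n. c i) \<le>
        (\<Sum>i<n. \<Sum>j<y. \<lfloor>M - lin \<alpha> \<beta> (x + (n - Suc i)) (y - Suc j)\<rfloor>)"
      unfolding c_def by (intro sum_mono) auto
    then show ?thesis
      using sum_rectangle_reflect[of "\<lambda>i j. \<lfloor>M - lin \<alpha> \<beta> (x + i) j\<rfloor>" n y] by simp
  qed
  \<comment> \<open>The last \<open>x\<close> columns of the bottom strip land in the top
    \<open>y\<close> rows of the leg.\<close>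
  have "(\<Sum>i<x. c (n + i)) \<le> S"
    unfolding S_def
  proof (rule sum_mono)
    fix i assume "i \<in> {..<x}"
    have "c (n + i) \<le> (\<Sum>j<y. \<phi> i (d + j))"
      unfolding c_def \<phi>_def using nd
      by (intro sum_mono floor_mono) (simp add: lin_def algebra_simps)
    also have "\<dots> = (\<Sum>j\<in>(+) d ` {..<y}. \<phi> i j)"
      by (simp add: sum.reindex)
    also have "\<dots> \<le> (\<Sum>j<b. \<phi> i j)"
      by (rule sum_mono2) (auto simp: b \<phi>_nonneg)
    finally show "c (n + i) \<le> (\<Sum>j<b. \<phi> i j)" .
  qed
  \<comment> \<open>The strip of \<open>x + n\<close> columns is split once after column
    \<open>x\<close> and once after column \<open>n\<close>. The factor 2 arises because
    \<open>S\<close> is counted for the leg itself and again for the translated columns.\<close>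
  moreover have "(\<Sum>i<x. c i) + (\<Sum>i<n. c (x + i)) = (\<Sum>i<n. c i) + (\<Sum>i<x. c (n + i))"
    by (metis sum_lessThan_add add.commute)
  moreover have "0 \<le> (\<Sum>i<x. c i)" "0 \<le> (\<Sum>i<n. c i)"
    unfolding c_def by (simp_all add: sum_nonneg \<phi>_nonneg)
  ultimately have "S + (\<Sum>i<n. c (x + i)) \<le> 2 * (S + (\<Sum>i<n. c i))"
    by (smt (verit))
  also have "\<dots> \<le> 2 * (\<Sum>(i, j)\<in>lshape a b x y. \<lfloor>M - lin \<alpha> \<beta> i j\<rfloor>)"
    unfolding sum_lshape[OF assms(4,6)] leg n_def[symmetric]
    using foot by (intro mult_left_mono add_left_mono) auto
  finally show ?thesis
    unfolding sum_lshape[OF assms(4,6)] S_def c_def \<phi>_def n_def M_def .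
qed

lemma sum_lshape_swap:
  "(\<Sum>(i, j)\<in>lshape b a y x. f j i) = (\<Sum>(i, j)\<in>lshape a b x y. f i j)"
  by (rule sum.reindex_bij_witness[of _ prod.swap prod.swap]) (auto simp: lshape_def)

text \<open>If the maximum lies at the end of the foot, exchanging the coordinates makes that end
  the top of the leg and reduces to \<open>floor_sum_lshape_le\<close>.\<close>

lemma floor_sum_lshape_le_max:
  fixes \<alpha> \<beta> M :: "'a::floor_ceiling"
  assumes "0 \<le> \<alpha>" "0 \<le> \<beta>" "1 \<le> x" "x \<le> a" "1 \<le> y" "y \<le> b"
    and M: "M = max (lin \<alpha> \<beta> (x - 1) (b - 1)) (lin \<alpha> \<beta> (a - 1) (y - 1))"
  shows "(\<Sum>(i, j)\<in>lshape a b x y. \<lfloor>lin \<alpha> \<beta> i j\<rfloor>) \<le>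
    2 * (\<Sum>(i, j)\<in>lshape a b x y. \<lfloor>M - lin \<alpha> \<beta> i j\<rfloor>)"
proof (cases "lin \<alpha> \<beta> (a - 1) (y - 1) \<le> lin \<alpha> \<beta> (x - 1) (b - 1)")
  case True
  then show ?thesis
    using floor_sum_lshape_le[OF assms(1-6)] M by (simp add: max_def)
next
  case False
  have swap: "lin \<alpha> \<beta> i j = lin \<beta> \<alpha> j i" for i j
    by (simp add: lin_def add.commute)
  have M': "M = lin \<beta> \<alpha> (y - 1) (a - 1)"
    using False M by (simp add: max_def swap)
  have "(\<Sum>(i, j)\<in>lshape b a y x. \<lfloor>lin \<beta> \<alpha> i j\<rfloor>) \<le>
      2 * (\<Sum>(i, j)\<in>lshape b a y x. \<lfloor>M - lin \<beta> \<alpha> i j\<rfloor>)"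
    unfolding M' using False assms(1-6) by (intro floor_sum_lshape_le) (auto simp: swap)
  then show ?thesis
    unfolding swap[of _ _, symmetric]
    by (simp add: sum_lshape_swap[of "\<lambda>i j. \<lfloor>lin \<alpha> \<beta> i j\<rfloor>"]
        sum_lshape_swap[of "\<lambda>i j. \<lfloor>M - lin \<alpha> \<beta> i j\<rfloor>"])
qed

section \<open>Lattice-tiling down-sets of the quadrant\<close>

definition down_closed :: "(nat \<times> nat) set \<Rightarrow> bool" where
  "down_closed D \<longleftrightarrow> (\<forall>i j i' j'. (i, j) \<in> D \<longrightarrow> i' \<le> i \<longrightarrow> j' \<le> j \<longrightarrow> (i', j') \<in> D)"

lemma down_closedD: "\<lbrakk>down_closed D; (i, j) \<in> D; i' \<le> i; j' \<le> j\<rbrakk> \<Longrightarrow> (i', j') \<in> D"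
  by (auto simp: down_closed_def)

text \<open>A lattice tiling expressed through differences: the conditions are the subgroup
  property, covering and packing. Disjointness of translates appears as the absence of nonzero
  differences of points of \<open>D\<close> in \<open>K\<close>.\<close>

definition tiles :: "(int \<times> int) set \<Rightarrow> (nat \<times> nat) set \<Rightarrow> bool" where
  "tiles K D \<longleftrightarrow>
    (\<forall>k\<in>K. \<forall>l\<in>K. k - l \<in> K) \<and>
    (\<forall>u v. \<exists>(i, j)\<in>D. (u - int i, v - int j) \<in> K) \<and>
    (\<forall>(i, j)\<in>D. \<forall>(i', j')\<in>D. (int i' - int i, int j' - int j) \<in> K \<longrightarrow> i' = i \<and> j' = j)"

text \<open>For a down-set these are the minimal elements of the complement that lie off the
  axes.\<close>

definition inner_corner :: "(nat \<times> nat) set \<Rightarrow> nat \<Rightarrow> nat \<Rightarrow> bool" where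
  "inner_corner D x y \<longleftrightarrow>
    0 < x \<and> 0 < y \<and> (x, y) \<notin> D \<and> (x - 1, y) \<in> D \<and> (x, y - 1) \<in> D"

text \<open>Write \<open>(x, y) = k + (i, j)\<close> with \<open>k\<close> in \<open>K\<close> and
  \<open>(i, j)\<close> in \<open>D\<close>. If \<open>i > 0\<close>, a step to the left gives
  \<open>(x - 1, y) = k + (i - 1, j)\<close> with both points in \<open>D\<close>, so packing forces
  \<open>k = 0\<close> and puts \<open>(x, y)\<close> in \<open>D\<close>. The same holds for
  \<open>j\<close>, hence \<open>k = (x, y)\<close>.\<close>

lemma tiles_inner_corner_mem:
  assumes dc: "down_closed D"
    and t: "tiles K D" and c: "inner_corner D x y"
  shows "(int x, int y) \<in> K"
proof -
  have unique: "i' = i \<and> j' = j"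
    if "(i, j) \<in> D" "(i', j') \<in> D" "(int i' - int i, int j' - int j) \<in> K" for i j i' j'
    using t that unfolding tiles_def by blast
  obtain i j where ij: "(i, j) \<in> D" "(int x - int i, int y - int j) \<in> K"
    using t unfolding tiles_def by blast
  have xy: "0 < x" "0 < y" "(x, y) \<notin> D" "(x - 1, y) \<in> D" "(x, y - 1) \<in> D"
    using c by (auto simp: inner_corner_def)
  have "i = 0"
  proof (rule ccontr)
    assume i: "i \<noteq> 0"
    then have "x - 1 = i - 1 \<and> y = j"
      using ij xy down_closedD[OF dc ij(1), of "i - 1" j] by (intro unique) (auto simp: of_nat_diff)
    then show False using xy ij i by (metis Suc_diff_1 neq0_conv)
  qed
  moreover have "j = 0"
  proof (rule ccontr)
    assume j: "j \<noteq> 0"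
    then have "x = i \<and> y - 1 = j - 1"
      using ij xy down_closedD[OF dc ij(1), of i "j - 1"] by (intro unique) (auto simp: of_nat_diff)
    then show False using xy ij j by (metis Suc_diff_1 neq0_conv)
  qed
  ultimately show ?thesis using ij by simp
qed

text \<open>Two corners with \<open>x < x'\<close> have \<open>y' < y\<close>, and their difference
  lies in \<open>K\<close>. It is also the difference of the axis points \<open>(x' - x, 0)\<close>
  and \<open>(0, y - y')\<close> of \<open>D\<close>, against packing.\<close>

lemma tiles_inner_corner_not_less:
  assumes dc: "down_closed D"
    and t: "tiles K D" and c: "inner_corner D x y" and c': "inner_corner D x' y'"
  shows "\<not> x < x'"
proof
  assume less: "x < x'"
  have xy: "0 < x" "0 < y" "(x, y) \<notin> D" "(x, y - 1) \<in> D" "0 < y'" "(x' - 1, y') \<in> D"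
    using c c' by (auto simp: inner_corner_def)
  have "y' < y"
    using down_closedD[OF dc xy(6), of x y] xy(3) less by linarith
  have "(x' - x, 0) \<in> D" "(0, y - y') \<in> D"
    using down_closedD[OF dc xy(6), of "x' - x" 0] down_closedD[OF dc xy(4), of 0 "y - y'"] xy by auto
  moreover have "(int (x' - x) - int 0, int 0 - int (y - y')) \<in> K"
  proof -
    have "(int x', int y') - (int x, int y) \<in> K"
      using t tiles_inner_corner_mem[OF dc t c] tiles_inner_corner_mem[OF dc t c']
      unfolding tiles_def by blast
    then show ?thesis using less \<open>y' < y\<close> by (simp add: of_nat_diff)
  qed
  ultimately have "x' - x = 0"
    using t unfolding tiles_def by blast
  then show False using less by simp
qed

lemma tiles_imp_lshape:
  assumes dc: "down_closed D"
    and t: "tiles K D" and fin: "finite D" and ne: "D \<noteq> {}"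
  obtains a b x y where "1 \<le> x" "x \<le> a" "1 \<le> y" "y \<le> b" "D = lshape a b x y"
proof -
  have O: "(0, 0) \<in> D"
    using ne down_closedD[OF dc] by fastforce
  have "finite (fst ` D)" "finite (snd ` D)"
    using fin by auto
  then obtain a0 b0 where "a0 \<notin> fst ` D" "b0 \<notin> snd ` D"
    using ex_new_if_finite infinite_UNIV_nat by metis
  then have ex: "(a0, 0) \<notin> D" "(0, b0) \<notin> D"
    by force+
  \<comment> \<open>The extents of \<open>D\<close> along the axes; they span its bounding
    box.\<close>
  define a b where "a = (LEAST i. (i, 0) \<notin> D)" and "b = (LEAST j. (0, j) \<notin> D)"
  have ab: "(a, 0) \<notin> D" "(0, b) \<notin> D"
    unfolding a_def b_def by (rule LeastI, rule ex)+
  have row: "(i, 0) \<in> D" if "i < a" for i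
    using not_less_Least[of i "\<lambda>i. (i, 0) \<notin> D"] that by (auto simp: a_def)
  have col: "(0, j) \<in> D" if "j < b" for j
    using not_less_Least[of j "\<lambda>j. (0, j) \<notin> D"] that by (auto simp: b_def)
  have pos: "0 < a" "0 < b"
    using ab O by (auto intro: gr0I)
  have bound: "i < a \<and> j < b" if "(i, j) \<in> D" for i j
    using down_closedD[OF dc that, of a 0] down_closedD[OF dc that, of 0 b] ab by (meson not_le zero_le)
  \<comment> \<open>Descent: a missing point of the box is off the axes, and it can move left or
    down outside \<open>D\<close> until both neighbours belong to \<open>D\<close>.\<close>
  have corner: "\<exists>x y. inner_corner D x y \<and> x \<le> i \<and> y \<le> j"
    if "(i, j) \<notin> D" "i < a" "j < b" for i j
    using that
  proof (induction "i + j" arbitrary: i j rule: less_induct)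
    case less
    have ij: "0 < i" "0 < j"
      using less.prems row col by (auto intro: gr0I)
    consider "(i - 1, j) \<notin> D" | "(i, j - 1) \<notin> D" | "inner_corner D i j"
      using ij less.prems by (auto simp: inner_corner_def)
    then show ?case
    proof cases
      case 1
      then obtain x y where "inner_corner D x y" "x \<le> i - 1" "y \<le> j"
        using less.hyps[of "i - 1" j] less.prems ij by (metis One_nat_def add_strict_right_mono add_strict_left_mono diff_less less_imp_diff_less zero_less_one)
      then show ?thesis by (meson diff_le_self le_trans)
    next
      case 2
      then obtain x y where "inner_corner D x y" "x \<le> i" "y \<le> j - 1"
        using less.hyps[of i "j - 1"] less.prems ij by (metis One_nat_def add_strict_right_mono add_strict_left_mono diff_less less_imp_diff_less zero_less_one)
      then show ?thesis by (meson diff_le_self le_trans)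
    qed auto
  qed
  show thesis
  proof (cases "\<exists>x y. inner_corner D x y")
    case False
    then have "(i, j) \<in> D \<longleftrightarrow> i < a \<and> j < b" for i j
      using bound corner by blast
    then have "D = lshape a b a b"
      by (auto simp: lshape_def)
    then show thesis
      using that pos by (metis One_nat_def Suc_leI order_refl)
  next
    case True
    then obtain x y where c: "inner_corner D x y" by blast
    \<comment> \<open>The comparison of corners settles the first coordinate; within one column,
      down-closedness allows only one corner.\<close>
    have unique: "x' = x \<and> y' = y" if c': "inner_corner D x' y'" for x' y'
    proof -
      have "x' = x"
        using tiles_inner_corner_not_less[OF dc t c c'] tiles_inner_corner_not_less[OF dc t c' c]
        by linarith
      have "0 < y" "0 < y'" "(x, y) \<notin> D" "(x, y') \<notin> D" "(x, y - 1) \<in> D" "(x, y' - 1) \<in> D"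
        using c c' \<open>x' = x\<close> by (simp_all add: inner_corner_def)
      then have "\<not> y \<le> y' - 1" "\<not> y' \<le> y - 1"
        using down_closedD[OF dc _ order_refl] by metis+
      with \<open>x' = x\<close> \<open>0 < y\<close> \<open>0 < y'\<close> show ?thesis by linarith
    qed
    have xy: "0 < x" "0 < y" "x \<le> a" "y \<le> b" "(x, y) \<notin> D"
      using c bound[of "x - 1" y] bound[of x "y - 1"] by (auto simp: inner_corner_def)
    have "D = lshape a b x y"
    proof (intro set_eqI iffI; clarify)
      fix i j assume "(i, j) \<in> D"
      then show "(i, j) \<in> lshape a b x y"
        using bound[of i j] down_closedD[OF dc, of i j x y] xy by (auto simp: lshape_def)
    next
      fix i j assume "(i, j) \<in> lshape a b x y"
      then show "(i, j) \<in> D"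
        using corner[of i j] unique unfolding lshape_def by blast
    qed
    then show thesis
      using that[of x a y b] xy by simp
  qed
qed

section \<open>The Wilf ratio\<close>

text \<open>Double counting by the value of \<open>f\<close>; it turns the level counts
  \<open>wilf_h\<close> and \<open>wilf_h'\<close> into sums over \<open>B\<close>.\<close>

lemma sum_times_card_fibre:
  fixes g :: "int \<Rightarrow> int"
  assumes "finite B" "finite N" "\<And>b. b \<in> B \<Longrightarrow> f b \<in> N"
  shows "(\<Sum>n\<in>N. of_int (g n) * of_nat (card {b \<in> B. f b = n})) =
    (of_int (\<Sum>b\<in>B. g (f b)) :: rat)"
proof -
  have "(\<Sum>n\<in>N. of_int (g n) * of_nat (card {b \<in> B. f b = n})) =
      (\<Sum>n\<in>N. \<Sum>b\<in>{b \<in> B. f b = n}. (of_int (g (f b)) :: rat))"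
    by (intro sum.cong refl) (simp add: mult.commute)
  also have "\<dots> = (\<Sum>b\<in>B. of_int (g (f b)))"
    using assms by (intro sum.group) auto
  finally show ?thesis by simp
qed

text \<open>On the level \<open>n\<close> of \<open>wilf_h'\<close> the weight
  \<open>wilf_n0 \<gamma> B - n\<close> is the floor of
  \<open>max_dot \<gamma> B - dot b \<gamma>\<close>. All levels fall in the range of summation, so
  no point of \<open>B\<close> is lost.\<close>

lemma wilf_ratio_eq:
  assumes fin: "finite B" and nonneg: "\<And>b. b \<in> B \<Longrightarrow> 0 \<le> dot b \<gamma>"
  shows "wilf_ratio \<gamma> B =
    of_int (\<Sum>b\<in>B. \<lfloor>max_dot \<gamma> B - dot b \<gamma>\<rfloor>) / of_int (\<Sum>b\<in>B. \<lfloor>dot b \<gamma>\<rfloor>)"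
proof -
  have max: "dot b \<gamma> \<le> max_dot \<gamma> B" if "b \<in> B" for b
    using fin that by (simp add: max_dot_def)
  have "\<lfloor>max_dot \<gamma> B - dot b \<gamma>\<rfloor> \<le> wilf_n0 \<gamma> B" if "b \<in> B" for b
    unfolding wilf_n0_def using nonneg[OF that] by (intro floor_mono) simp
  moreover have "0 \<le> \<lfloor>max_dot \<gamma> B - dot b \<gamma>\<rfloor>" if "b \<in> B" for b
    using max[OF that] by simp
  ultimately have "(\<Sum>n\<in>{0..wilf_n0 \<gamma> B}. of_int (wilf_n0 \<gamma> B - n) * of_nat (wilf_h' \<gamma> B n)) =
      (of_int (\<Sum>b\<in>B. \<lfloor>max_dot \<gamma> B - dot b \<gamma>\<rfloor>) :: rat)"
    unfolding wilf_h'_def using fin by (subst sum_times_card_fibre) auto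
  moreover have "\<lfloor>dot b \<gamma>\<rfloor> \<le> wilf_n0 \<gamma> B" "0 \<le> \<lfloor>dot b \<gamma>\<rfloor>" if "b \<in> B" for b
    unfolding wilf_n0_def using max[OF that] nonneg[OF that] by (auto intro: floor_mono)
  then have "(\<Sum>n\<in>{0..wilf_n0 \<gamma> B}. of_int n * of_nat (wilf_h \<gamma> B n)) =
      (of_int (\<Sum>b\<in>B. \<lfloor>dot b \<gamma>\<rfloor>) :: rat)"
    unfolding wilf_h_def using fin by (subst sum_times_card_fibre) auto
  ultimately show ?thesis
    by (simp only: wilf_ratio_def)
qed

lemma periodic_tesselation_imp_tiles:
  fixes B :: "(nat ^ 2) set"
  assumes "induces_periodic_tesselation B"
  obtains K where "tiles K ((\<lambda>v. (v $ 1, v $ 2)) ` B)"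
proof -
  obtain L where L: "sublattice L" and cover: "(\<Union>l\<in>L. translate l B) = UNIV"
    and disj: "disjoint_family_on (\<lambda>l. translate l B) L"
    using assms unfolding induces_periodic_tesselation_def by blast
  define K where "K = (\<lambda>v. (v $ 1, v $ 2)) ` L"
  have memK: "l \<in> L" if mem: "(l $ 1, l $ 2) \<in> K" for l :: "int ^ 2"
  proof -
    obtain v where "v \<in> L" "l $ 1 = v $ 1" "l $ 2 = v $ 2"
      using mem unfolding K_def image_iff prod.inject by blast
    moreover from this have "l = v"
      by (simp add: vec_eq_iff forall_2)
    ultimately show ?thesis by simp
  qed
  have "k - l \<in> K" if kl: "k \<in> K" "l \<in> K" for k l
  proof -
    obtain u v where uv: "u \<in> L" "v \<in> L" "k = (u $ 1, u $ 2)" "l = (v $ 1, v $ 2)"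
      using kl by (auto simp: K_def)
    then have "u + - v \<in> L"
      using L unfolding sublattice_def by blast
    then show ?thesis
      using uv by (force simp: K_def)
  qed
  moreover have "\<exists>(i, j)\<in>(\<lambda>v. (v $ 1, v $ 2)) ` B. (u - int i, v - int j) \<in> K" for u v
  proof -
    have "(vector [u, v] :: int ^ 2) \<in> (\<Union>l\<in>L. translate l B)"
      using cover by simp
    then obtain l b where lb: "l \<in> L" "b \<in> B" "vector [u, v] = l + int_of_nat_vec b"
      by (auto simp: translate_def)
    from lb(3) have "u = l $ 1 + int (b $ 1)" "v = l $ 2 + int (b $ 2)"
      by (simp_all add: vec_eq_iff forall_2 int_of_nat_vec_def)
    then show ?thesis
      using lb by (auto simp: K_def intro!: bexI[of _ b])
  qed
  moreover have "i' = i \<and> j' = j"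
    if "(i, j) \<in> (\<lambda>v. (v $ 1, v $ 2)) ` B" "(i', j') \<in> (\<lambda>v. (v $ 1, v $ 2)) ` B"
      and k: "(int i' - int i, int j' - int j) \<in> K" for i j i' j'
  proof -
    obtain b b' where b: "b \<in> B" "i = b $ 1" "j = b $ 2" and b': "b' \<in> B" "i' = b' $ 1" "j' = b' $ 2"
      using \<open>(i, j) \<in> _\<close> \<open>(i', j') \<in> _\<close> by auto
    \<comment> \<open>The point \<open>b'\<close> lies in the translates by \<open>l\<close> and by
      \<open>0\<close>, so disjointness forces \<open>l = 0\<close>.\<close>
    define l where "l = int_of_nat_vec b' - int_of_nat_vec b"
    have "l \<in> L"
      using k b b' by (intro memK) (simp add: l_def int_of_nat_vec_def)
    have "int_of_nat_vec b' \<in> translate l B" "int_of_nat_vec b' \<in> translate 0 B"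
      using b b' by (auto simp: translate_def l_def)
    moreover have "0 \<in> L"
      using L by (simp add: sublattice_def)
    ultimately have "l = 0"
      using disj \<open>l \<in> L\<close> unfolding disjoint_family_on_def by blast
    then have "int_of_nat_vec b' = int_of_nat_vec b"
      by (simp add: l_def)
    then show ?thesis
      using b b' by (simp add: int_of_nat_vec_def vec_eq_iff forall_2)
  qed
  ultimately have "tiles K ((\<lambda>v. (v $ 1, v $ 2)) ` B)"
    unfolding tiles_def by blast
  then show thesis by (rule that)
qed

theorem mainTheorem2:
  fixes \<gamma> :: "rat ^ 2" and B C :: "(nat ^ 2) set"
  assumes "1 \<le> \<gamma> $ 1" and "\<gamma> $ 1 \<le> \<gamma> $ 2"
    and "finite B" and "B \<noteq> {}" and "B \<noteq> {0}"
    and "C = UNIV - B"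
    and "\<forall>c\<in>C. \<forall>x. c + x \<in> C"
    and "induces_periodic_tesselation B"
  shows "wilf_ratio \<gamma> B \<ge> 1 / 2"
proof -
  let ?e = "\<lambda>v :: nat ^ 2. (v $ 1, v $ 2)"
  define D where "D = ?e ` B"
  have inj: "inj_on ?e B"
    by (auto intro!: inj_onI simp: vec_eq_iff forall_2)
  have lin: "dot v \<gamma> = lin (\<gamma> $ 1) (\<gamma> $ 2) (v $ 1) (v $ 2)" for v
    by (simp add: dot_def sum_2 lin_def)
  have "down_closed D"
    unfolding down_closed_def
  proof (intro allI impI)
    fix i j i' j' assume that: "(i, j) \<in> D" "i' \<le> i" "j' \<le> j"
    obtain b where b: "b \<in> B" "i = b $ 1" "j = b $ 2"
      using \<open>(i, j) \<in> D\<close> by (auto simp: D_def)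
    define c :: "nat ^ 2" where "c = vector [i', j']"
    have "b = c + vector [i - i', j - j']"
      using that b by (simp add: c_def vec_eq_iff forall_2)
    \<comment> \<open>Otherwise \<open>c\<close> would be in \<open>C\<close>, and so would
      \<open>b\<close>, which is \<open>c\<close> plus a vector.\<close>
    then have "c \<in> B"
      using assms(6,7) b(1) by auto
    then show "(i', j') \<in> D"
      by (force simp: D_def c_def)
  qed
  have "finite D" "D \<noteq> {}"
    using assms by (auto simp: D_def)
  moreover obtain K where "tiles K D"
    unfolding D_def using assms(8) by (rule periodic_tesselation_imp_tiles)
  ultimately obtain a b x y where xy: "1 \<le> x" "x \<le> a" "1 \<le> y" "y \<le> b" and shape: "D = lshape a b x y"
    using tiles_imp_lshape[OF \<open>down_closed D\<close>] by metis
  let ?l = "lin (\<gamma> $ 1) (\<gamma> $ 2)"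
  have pos: "0 \<le> \<gamma> $ 1" "0 \<le> \<gamma> $ 2"
    using assms(1,2) by auto
  have mono: "?l i j \<le> ?l i' j'" if "i \<le> i'" "j \<le> j'" for i j i' j'
    using that pos by (auto simp: lin_def intro!: add_mono mult_right_mono)
  have "max_dot \<gamma> B = Max ((\<lambda>(i, j). ?l i j) ` D)"
    by (simp add: max_dot_def D_def image_image lin)
  also have "\<dots> = max (?l (x - 1) (b - 1)) (?l (a - 1) (y - 1))"
  proof (rule Max_eqI)
    show "finite ((\<lambda>(i, j). ?l i j) ` D)"
      using \<open>finite D\<close> by simp
    have "(x - 1, b - 1) \<in> D" "(a - 1, y - 1) \<in> D"
      using xy by (auto simp: shape lshape_def)
    then show "max (?l (x - 1) (b - 1)) (?l (a - 1) (y - 1)) \<in> (\<lambda>(i, j). ?l i j) ` D"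
      by (force simp: max_def)
    fix m assume "m \<in> (\<lambda>(i, j). ?l i j) ` D"
    then obtain i j where ij: "(i, j) \<in> D" "m = ?l i j" by auto
    \<comment> \<open>Every point of the L lies below one of its two outer corners, so monotonicity
      leaves only these as candidates for the maximum.\<close>
    then have "i \<le> x - 1 \<and> j \<le> b - 1 \<or> i \<le> a - 1 \<and> j \<le> y - 1"
      by (auto simp: shape lshape_def)
    then show "m \<le> max (?l (x - 1) (b - 1)) (?l (a - 1) (y - 1))"
      using mono ij(2) by (metis max.coboundedI1 max.coboundedI2)
  qed
  finally have M: "max_dot \<gamma> B = max (?l (x - 1) (b - 1)) (?l (a - 1) (y - 1))" .
  define num den where "num = (\<Sum>v\<in>B. \<lfloor>max_dot \<gamma> B - dot v \<gamma>\<rfloor>)"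
    and "den = (\<Sum>v\<in>B. \<lfloor>dot v \<gamma>\<rfloor>)"
  have "num = (\<Sum>(i, j)\<in>D. \<lfloor>max_dot \<gamma> B - ?l i j\<rfloor>)" "den = (\<Sum>(i, j)\<in>D. \<lfloor>?l i j\<rfloor>)"
    by (simp_all add: num_def den_def D_def sum.reindex[OF inj] lin)
  then have "den \<le> 2 * num"
    unfolding shape using floor_sum_lshape_le_max[OF pos xy M] by simp
  have nonneg: "0 \<le> dot v \<gamma>" for v
    using pos by (simp add: lin lin_def)
  obtain v where v: "v \<in> B" "v \<noteq> 0"
    using assms(4,5) by blast
  \<comment> \<open>Division by zero yields 0, so the bound requires a positive denominator. A
    nonzero \<open>v\<close> in \<open>B\<close> dominates a unit vector, whose product with
    \<open>\<gamma>\<close> is at least 1.\<close>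
  have "0 < den"
    unfolding den_def
  proof (rule sum_pos2[OF \<open>finite B\<close> v(1)])
    have "1 \<le> v $ 1 \<or> 1 \<le> v $ 2"
      using v(2) by (auto simp: vec_eq_iff forall_2 Suc_le_eq)
    then have "?l 1 0 \<le> dot v \<gamma> \<or> ?l 0 1 \<le> dot v \<gamma>"
      using mono unfolding lin by blast
    then have "1 \<le> dot v \<gamma>"
      using assms(1,2) by (auto simp: lin_def)
    then show "0 < \<lfloor>dot v \<gamma>\<rfloor>"
      by (simp add: zero_less_floor)
  qed (use nonneg in simp)
  have "wilf_ratio \<gamma> B = of_int num / of_int den"
    unfolding num_def den_def using wilf_ratio_eq[OF \<open>finite B\<close> nonneg] .
  moreover have "(of_int den :: rat) \<le> 2 * of_int num"
    using \<open>den \<le> 2 * num\<close> by (metis of_int_le_iff of_int_mult of_int_numeral)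
  ultimately show ?thesis
    using \<open>0 < den\<close> by (simp add: pos_le_divide_eq)
qed

end
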